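(* There exist a finite simplicial graph $\Gamma$, an integer $n$, and an injective homomorphism $F_n\to A_\Gamma$ from the free group $F_n$ of rank $n$ to the right-angled Artin group $A_\Gamma$ that is not a quasi-isometric embedding (with respect to word metrics from finite generating sets).
   Context: The right-angled Artin group $A_\Gamma$ is the group with generating set the vertices $V$ of $\Gamma$ and relations $v_iv_j=v_jv_i$ for each edge $(v_i,v_j)$ of $\Gamma$. For a finite generating set $S$ of a group $G$, the word metric is $d(g_1,g_2)=$ the length of a shortest word in $S^{\pm1}$ representing $g_1^{-1}g_2$. A map $f:Y\to Z$ of metric spaces is a quasi-isometric embedding if there are constants $\lambda\ge 1$, $\epsilon\ge 0$ with $\frac1\lambda d_Y(p,q)-\epsilon\le d_Z(f(p),f(q))\le\lambda d_Y(p,q)+\epsilon$ for all $p,q\in Y$ (for word metrics, this does not depend on the choice of finite generating sets). *)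

theory Defs
  imports Complex_Main "HOL-Algebra.Generated_Groups"
begin

section \<open>Groups given by generators and relations\<close>

text \<open>A letter \<open>(x, True)\<close> stands for the generator \<open>x\<close> and \<open>(x, False)\<close> for its formal inverse.\<close>

type_synonym 'a word = "('a \<times> bool) list"

definition words :: "'a set \<Rightarrow> 'a word set" where
  "words X = lists (X \<times> UNIV)"

text \<open>A pair \<open>(u, v) \<in> R\<close> is the relation \<open>u = v\<close>.\<close>

inductive pres_eq :: "'a set \<Rightarrow> ('a word \<times> 'a word) set \<Rightarrow> 'a word \<Rightarrow> 'a word \<Rightarrow> bool"
  for X :: "'a set" and R :: "('a word \<times> 'a word) set" where
  refl: "w \<in> words X \<Longrightarrow> pres_eq X R w w"
| sym: "pres_eq X R u v \<Longrightarrow> pres_eq X R v u"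
| trans: "pres_eq X R u v \<Longrightarrow> pres_eq X R v w \<Longrightarrow> pres_eq X R u w"
| append: "pres_eq X R u u' \<Longrightarrow> pres_eq X R v v' \<Longrightarrow> pres_eq X R (u @ v) (u' @ v')"
| cancel: "x \<in> X \<Longrightarrow> pres_eq X R [(x, b), (x, \<not> b)] []"
| rel: "(u, v) \<in> R \<Longrightarrow> u \<in> words X \<Longrightarrow> v \<in> words X \<Longrightarrow> pres_eq X R u v"

definition word_class :: "'a set \<Rightarrow> ('a word \<times> 'a word) set \<Rightarrow> 'a word \<Rightarrow> 'a word set" where
  "word_class X R w = {v. pres_eq X R w v}"

definition presented_group ::
    "'a set \<Rightarrow> ('a word \<times> 'a word) set \<Rightarrow> 'a word set monoid" where
  "presented_group X R =
     \<lparr> carrier = word_class X R ` words X,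
       mult = (\<lambda>A B. \<Union>a\<in>A. \<Union>b\<in>B. word_class X R (a @ b)),
       one = word_class X R [] \<rparr>"

lemma pres_eq_words: "pres_eq X R u v \<Longrightarrow> u \<in> words X \<and> v \<in> words X"
  by (induction rule: pres_eq.induct) (auto simp: words_def)

lemma word_class_eq_iff:
  assumes "u \<in> words X"
  shows "word_class X R u = word_class X R v \<longleftrightarrow> pres_eq X R u v"
  using assms unfolding word_class_def by (auto intro: pres_eq.intros)

lemma presented_group_mult:
  assumes "u \<in> words X" "v \<in> words X"
  shows "word_class X R u \<otimes>\<^bsub>presented_group X R\<^esub> word_class X R v = word_class X R (u @ v)"
  using assms
  by (auto simp: presented_group_def word_class_def intro: pres_eq.intros)

lemma pres_eq_inverse:
  assumes "w \<in> words X"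
  shows "pres_eq X R (rev (map (\<lambda>(x, b). (x, \<not> b)) w) @ w) []"
  using assms
proof (induction w)
  case Nil
  then show ?case by (auto simp: words_def intro: pres_eq.refl)
next
  case (Cons a w)
  obtain x b where a: "a = (x, b)" by (cases a)
  have x: "x \<in> X" and w: "w \<in> words X" using Cons.prems by (auto simp: a words_def)
  let ?i = "rev (map (\<lambda>(x, b). (x, \<not> b)) w)"
  have i: "?i \<in> words X" using w by (auto simp: words_def)
  have "pres_eq X R ([(x, \<not> b), (x, b)] @ w) ([] @ w)"
    using pres_eq.append[OF pres_eq.cancel[OF x, where b = "\<not> b"] pres_eq.refl[OF w]] by simp
  then have "pres_eq X R (?i @ [(x, \<not> b), (x, b)] @ w) (?i @ w)"
    using pres_eq.append[OF pres_eq.refl[OF i]] by force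
  then show ?case using Cons.IH[OF w] by (auto simp: a intro: pres_eq.trans)
qed

lemma group_presented_group: "group (presented_group X R)"
proof -
  let ?G = "presented_group X R"
  have carrier: "carrier ?G = word_class X R ` words X"
    and one: "\<one>\<^bsub>?G\<^esub> = word_class X R []"
    by (auto simp: presented_group_def)
  have nil: "[] \<in> words X" and app: "\<And>u v. u \<in> words X \<Longrightarrow> v \<in> words X \<Longrightarrow> u @ v \<in> words X"
    by (auto simp: words_def)
  show ?thesis
  proof (rule groupI)
    fix a assume "a \<in> carrier ?G"
    then obtain w where w: "w \<in> words X" "a = word_class X R w" by (auto simp: carrier)
    let ?i = "rev (map (\<lambda>(x, b). (x, \<not> b)) w)"
    have i: "?i \<in> words X" using w by (auto simp: words_def)
    have "word_class X R ?i \<otimes>\<^bsub>?G\<^esub> a = \<one>\<^bsub>?G\<^esub>"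
      using w i pres_eq_inverse[OF w(1)]
      by (simp add: presented_group_mult one word_class_eq_iff app)
    then show "\<exists>b\<in>carrier ?G. b \<otimes>\<^bsub>?G\<^esub> a = \<one>\<^bsub>?G\<^esub>" using i by (auto simp: carrier)
  qed (use nil app in \<open>auto simp: carrier one presented_group_mult\<close>)
qed

definition free_group_of_rank :: "nat \<Rightarrow> nat word set monoid" where
  "free_group_of_rank n = presented_group {..<n} {}"


section \<open>Right-angled Artin groups\<close>

definition finite_simplicial_graph :: "'a set \<Rightarrow> 'a set set \<Rightarrow> bool" where
  "finite_simplicial_graph V E \<longleftrightarrow> finite V \<and> (\<forall>e\<in>E. e \<subseteq> V \<and> card e = 2)"

definition raag :: "'a set \<Rightarrow> 'a set set \<Rightarrow> 'a word set monoid" where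
  "raag V E =
     presented_group V {([(u, True), (v, True)], [(v, True), (u, True)]) | u v. {u, v} \<in> E}"


section \<open>Word metrics and quasi-isometric embeddings\<close>

definition finite_generating_set :: "('g, 'm) monoid_scheme \<Rightarrow> 'g set \<Rightarrow> bool" where
  "finite_generating_set G S \<longleftrightarrow> finite S \<and> S \<subseteq> carrier G \<and> generate G S = carrier G"

definition word_length :: "('g, 'm) monoid_scheme \<Rightarrow> 'g set \<Rightarrow> 'g \<Rightarrow> nat" where
  "word_length G S g =
     (LEAST k. \<exists>ws. set ws \<subseteq> S \<union> m_inv G ` S \<and> length ws = k \<and>
                    foldr (mult G) ws \<one>\<^bsub>G\<^esub> = g)"

definition word_dist :: "('g, 'm) monoid_scheme \<Rightarrow> 'g set \<Rightarrow> 'g \<Rightarrow> 'g \<Rightarrow> real" where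
  "word_dist G S g h = real (word_length G S (inv\<^bsub>G\<^esub> g \<otimes>\<^bsub>G\<^esub> h))"

definition quasi_isometric_embedding ::
    "'a set \<Rightarrow> ('a \<Rightarrow> 'a \<Rightarrow> real) \<Rightarrow> ('b \<Rightarrow> 'b \<Rightarrow> real) \<Rightarrow> ('a \<Rightarrow> 'b) \<Rightarrow> bool" where
  "quasi_isometric_embedding Y dY dZ f \<longleftrightarrow>
     (\<exists>L\<ge>1. \<exists>\<epsilon>\<ge>0. \<forall>p\<in>Y. \<forall>q\<in>Y.
        (1 / L) * dY p q - \<epsilon> \<le> dZ (f p) (f q) \<and> dZ (f p) (f q) \<le> L * dY p q + \<epsilon>)"

lemma (in group) word_exists:
  assumes "S \<subseteq> carrier G" "g \<in> generate G S"
  shows "\<exists>ws. set ws \<subseteq> S \<union> m_inv G ` S \<and> foldr (mult G) ws \<one> = g"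
proof -
  have app: "foldr (mult G) (us @ vs) \<one> = foldr (mult G) us \<one> \<otimes> foldr (mult G) vs \<one>
      \<and> foldr (mult G) us \<one> \<in> carrier G"
    if "set us \<subseteq> S \<union> m_inv G ` S" "set vs \<subseteq> S \<union> m_inv G ` S" for us vs
  proof -
    have c: "S \<union> m_inv G ` S \<subseteq> carrier G" using assms(1) by auto
    have v: "foldr (mult G) ws \<one> \<in> carrier G" if "set ws \<subseteq> S \<union> m_inv G ` S" for ws
      using that c by (induction ws) auto
    have "foldr (mult G) (us @ vs) \<one> = foldr (mult G) us \<one> \<otimes> foldr (mult G) vs \<one>"
      using that(1)
    proof (induction us)
      case Nil
      then show ?case using v[OF that(2)] by simp
    next
      case (Cons a us)
      then have "a \<in> carrier G" "set us \<subseteq> S \<union> m_inv G ` S" using c by auto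
      then show ?case using Cons.IH v v[OF that(2)] by (simp add: m_assoc)
    qed
    then show ?thesis using v[OF that(1)] by blast
  qed
  show ?thesis
    using assms(2)
  proof (induction rule: generate.induct)
    case one
    show ?case by (rule exI[of _ "[]"]) simp
  next
    case (incl h)
    then show ?case using assms(1) by (intro exI[of _ "[h]"]) auto
  next
    case (inv h)
    then show ?case using assms(1) by (intro exI[of _ "[inv h]"]) auto
  next
    case (eng h1 h2)
    then obtain us vs where "set us \<subseteq> S \<union> m_inv G ` S" "foldr (mult G) us \<one> = h1"
      "set vs \<subseteq> S \<union> m_inv G ` S" "foldr (mult G) vs \<one> = h2" by blast
    then show ?case using app[of us vs] by (intro exI[of _ "us @ vs"]) auto
  qed
qed

lemma finite_generating_set_presented_group:
  assumes "finite X"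
  shows "finite_generating_set (presented_group X R) ((\<lambda>x. word_class X R [(x, True)]) ` X)"
proof -
  let ?G = "presented_group X R"
  let ?S = "(\<lambda>x. word_class X R [(x, True)]) ` X"
  interpret group ?G by (rule group_presented_group)
  have carrier: "carrier ?G = word_class X R ` words X"
    and one: "\<one>\<^bsub>?G\<^esub> = word_class X R []"
    by (auto simp: presented_group_def)
  have S: "?S \<subseteq> carrier ?G" by (auto simp: carrier words_def)
  have letter: "word_class X R [(x, b)] \<in> generate ?G ?S" if x: "x \<in> X" for x b
  proof (cases b)
    case True
    then show ?thesis using x by (auto intro: generate.incl)
  next
    case False
    have W: "[(x, True)] \<in> words X" "[(x, False)] \<in> words X" "[(x, False), (x, True)] \<in> words X"
      using x by (auto simp: words_def)
    have "word_class X R [(x, False)] \<otimes>\<^bsub>?G\<^esub> word_class X R [(x, True)] = \<one>\<^bsub>?G\<^esub>"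
      using pres_eq.cancel[OF x, of R False] W
      by (simp add: presented_group_mult one word_class_eq_iff)
    then have "word_class X R [(x, False)] = inv\<^bsub>?G\<^esub> (word_class X R [(x, True)])"
      using W by (intro inv_equality[symmetric]) (auto simp: carrier)
    then show ?thesis using x False by (auto intro: generate.inv)
  qed
  have "word_class X R w \<in> generate ?G ?S" if "w \<in> words X" for w
    using that
  proof (induction w)
    case Nil
    then show ?case using generate.one[of ?G ?S] by (simp add: one)
  next
    case (Cons a w)
    obtain x b where a: "a = (x, b)" by (cases a)
    have x: "x \<in> X" and w: "w \<in> words X" and l: "[(x, b)] \<in> words X"
      using Cons.prems by (auto simp: a words_def)
    show ?case
      using generate.eng[OF letter[OF x, of b] Cons.IH[OF w]] presented_group_mult[OF l w, of R]
      by (simp add: a)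
  qed
  then have "generate ?G ?S = carrier ?G"
    using generate_incl[OF S] by (auto simp: carrier)
  then show ?thesis using assms S by (simp add: finite_generating_set_def)
qed

end

theory Submission
  imports Defs
begin

text \<open>
  Take the path \<open>a - b - c - d\<close> (the vertices \<open>0, 1, 2, 3\<close>). The kernel of the map of its
  right-angled Artin group \<open>A\<close> onto the integers that sends every vertex to 1 is free on
  \<open>x = a b\<^sup>-\<^sup>1\<close>, \<open>y = b c\<^sup>-\<^sup>1\<close>, \<open>z = c d\<^sup>-\<^sup>1\<close>. Indeed, conjugation by \<open>c\<close> sends \<open>x\<close> to
  \<open>y\<^sup>-\<^sup>1 x y\<close> and fixes \<open>y\<close> and \<open>z\<close>; calling this automorphism \<open>\<phi>\<close>, the group \<open>A\<close> acts on the
  free group \<open>F\<^sub>3\<close> by \<open>a: g \<mapsto> x y \<phi>(g)\<close>, \<open>b: g \<mapsto> y \<phi>(g)\<close>, \<open>c: g \<mapsto> \<phi>(g)\<close>, \<open>d: g \<mapsto> z\<^sup>-\<^sup>1 \<phi>(g)\<close>,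
  and \<open>F\<^sub>3\<close> acts through \<open>A\<close> by left translations, so \<open>F\<^sub>3 \<rightarrow> A\<close> is injective.

  The element \<open>(a d)\<^sup>k c\<^sup>-\<^sup>2\<^sup>k\<close> of the kernel has length at most \<open>4 k\<close> in \<open>A\<close>, but it is the product
  over \<open>i < k\<close> of the words \<open>y\<^sup>-\<^sup>2\<^sup>i x y\<^sup>2\<^sup>i\<^sup>+\<^sup>1 z\<^sup>-\<^sup>1\<close>, which is reduced of length \<open>2 k\<^sup>2 + k\<close>.
\<close>

section \<open>Words and substitutions\<close>

definition letter_inverse :: "'a \<times> bool \<Rightarrow> 'a \<times> bool" where
  "letter_inverse = (\<lambda>(x, b). (x, \<not> b))"

definition word_inverse :: "'a word \<Rightarrow> 'a word" where
  "word_inverse w = rev (map (\<lambda>(x, b). (x, \<not> b)) w)"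

definition substitute :: "('a \<Rightarrow> 'b word) \<Rightarrow> 'a word \<Rightarrow> 'b word" where
  "substitute f w = concat (map (\<lambda>(x, b). if b then f x else word_inverse (f x)) w)"

lemma letter_inverse_simps [simp]:
  "letter_inverse (x, b) = (x, \<not> b)"
  "letter_inverse (letter_inverse l) = l"
  by (auto simp: letter_inverse_def split: prod.splits)

lemma words_simps [simp]:
  "[] \<in> words X"
  "l # w \<in> words X \<longleftrightarrow> fst l \<in> X \<and> w \<in> words X"
  "u @ v \<in> words X \<longleftrightarrow> u \<in> words X \<and> v \<in> words X"
  by (cases l; auto simp: words_def)+

lemma word_inverse_simps [simp]:
  "word_inverse [] = []"
  "word_inverse ((x, b) # w) = word_inverse w @ [(x, \<not> b)]"
  "word_inverse (u @ v) = word_inverse v @ word_inverse u"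
  "word_inverse (word_inverse w) = w"
  by (auto simp: word_inverse_def rev_map comp_def case_prod_unfold)

lemma word_inverse_in_words [simp]: "word_inverse w \<in> words X \<longleftrightarrow> w \<in> words X"
  by (induction w) auto

lemma substitute_simps [simp]:
  "substitute f [] = []"
  "substitute f ((x, True) # w) = f x @ substitute f w"
  "substitute f ((x, False) # w) = word_inverse (f x) @ substitute f w"
  "substitute f (u @ v) = substitute f u @ substitute f v"
  by (auto simp: substitute_def)

lemma substitute_Cons:
  "substitute f ((x, b) # w) = (if b then f x else word_inverse (f x)) @ substitute f w"
  by simp

lemma substitute_in_words:
  assumes "\<And>x. x \<in> X \<Longrightarrow> f x \<in> words Y" "w \<in> words X"
  shows "substitute f w \<in> words Y"
  using assms(2) by (induction w) (auto simp: substitute_Cons assms(1))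

lemma substitute_word_inverse:
  "substitute f (word_inverse w) = word_inverse (substitute f w)"
  by (induction w) (auto simp: substitute_Cons)

lemma substitute_substitute:
  "substitute g (substitute f w) = substitute (\<lambda>x. substitute g (f x)) w"
  by (induction w) (auto simp: substitute_Cons substitute_word_inverse)

lemma substitute_generators: "substitute (\<lambda>x. [(x, True)]) w = w"
  by (induction w) (auto simp: substitute_Cons)

section \<open>Equality of words in a presented group\<close>

lemma pres_eq_inverse_left: "w \<in> words X \<Longrightarrow> pres_eq X R (word_inverse w @ w) []"
  using pres_eq_inverse by (simp add: word_inverse_def)

lemma pres_eq_inverse_right: "w \<in> words X \<Longrightarrow> pres_eq X R (w @ word_inverse w) []"
  using pres_eq_inverse_left[of "word_inverse w"] by simp

lemma pres_eq_append_left: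
  "pres_eq X R u v \<Longrightarrow> w \<in> words X \<Longrightarrow> pres_eq X R (w @ u) (w @ v)"
  by (blast intro: pres_eq.intros)

lemma pres_eq_append_right:
  "pres_eq X R u v \<Longrightarrow> w \<in> words X \<Longrightarrow> pres_eq X R (u @ w) (v @ w)"
  by (blast intro: pres_eq.intros)

text \<open>With \<open>i\<close> and \<open>j\<close> the inverses of \<open>u\<close> and
  \<open>v\<close>, the word \<open>i u j\<close> equals \<open>j\<close>, and replacing
  \<open>u\<close> by \<open>v\<close> in it gives \<open>i v j\<close>, which equals
  \<open>i\<close>.\<close>

lemma pres_eq_word_inverse:
  assumes "pres_eq X R u v"
  shows "pres_eq X R (word_inverse u) (word_inverse v)"
proof -
  have uv: "u \<in> words X" "v \<in> words X" using pres_eq_words[OF assms] by auto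
  let ?i = "word_inverse u" and ?j = "word_inverse v"
  have "pres_eq X R ((?i @ u) @ ?j) ([] @ ?j)"
    by (intro pres_eq_append_right pres_eq_inverse_left) (use uv in auto)
  moreover have "pres_eq X R (?i @ u @ ?j) (?i @ v @ ?j)"
    by (intro pres_eq_append_left pres_eq_append_right assms) (use uv in auto)
  moreover have "pres_eq X R (?i @ v @ ?j) (?i @ [])"
    by (intro pres_eq_append_left pres_eq_inverse_right) (use uv in auto)
  ultimately show ?thesis
    by (simp del: append_assoc add: append_assoc[symmetric]) (blast intro: pres_eq.trans pres_eq.sym)
qed

text \<open>Von Dyck's principle on words: a substitution that respects the defining relations
  respects every consequence of them, since free cancellations are preserved automatically.\<close>

lemma substitute_pres_eq:
  assumes "\<And>x. x \<in> X \<Longrightarrow> f x \<in> words Y"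
    and "\<And>u v. (u, v) \<in> R \<Longrightarrow> u \<in> words X \<Longrightarrow> v \<in> words X
           \<Longrightarrow> pres_eq Y Q (substitute f u) (substitute f v)"
    and "pres_eq X R u v"
  shows "pres_eq Y Q (substitute f u) (substitute f v)"
  using assms(3)
proof (induction rule: pres_eq.induct)
  case (refl w)
  then show ?case using assms(1) by (auto intro: pres_eq.refl substitute_in_words)
next
  case (cancel x b)
  then show ?case
    using assms(1)[OF cancel] pres_eq_inverse_left[of "f x" Y Q] pres_eq_inverse_right[of "f x" Y Q]
    by (cases b) auto
next
  case (append u u' v v')
  then show ?case by (simp add: pres_eq.append)
qed (blast intro: pres_eq.sym pres_eq.trans assms(2))+

text \<open>Lets an identity between two homomorphisms out of a free group be checked on the
  generators; it serves to invert \<open>monodromy\<close>.\<close>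

lemma substitute_cong_pres_eq:
  assumes "\<And>x. x \<in> X \<Longrightarrow> pres_eq Y Q (f x) (g x)" "w \<in> words X"
  shows "pres_eq Y Q (substitute f w) (substitute g w)"
  using assms(2)
  by (induction w)
    (auto simp: substitute_Cons intro!: pres_eq.append pres_eq.refl assms(1) pres_eq_word_inverse)

text \<open>A union over all representatives avoids choosing one. On a class of a free group every
  member contributes the same class, so the union is a single class of the target.\<close>

definition substitute_class ::
    "'b set \<Rightarrow> ('b word \<times> 'b word) set \<Rightarrow> ('a \<Rightarrow> 'b word) \<Rightarrow> 'a word set \<Rightarrow> 'b word set" where
  "substitute_class Y Q f A = (\<Union>a\<in>A. word_class Y Q (substitute f a))"

lemma substitute_class_word_class:
  assumes "\<And>x. x \<in> X \<Longrightarrow> f x \<in> words Y" "w \<in> words X"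
  shows "substitute_class Y Q f (word_class X {} w) = word_class Y Q (substitute f w)"
proof -
  have "word_class Y Q (substitute f w) = word_class Y Q (substitute f v)"
    if "v \<in> word_class X {} w" for v
  proof -
    have "pres_eq X {} w v" using that by (simp add: word_class_def)
    then have "pres_eq Y Q (substitute f w) (substitute f v)"
      using assms(1) by (rule substitute_pres_eq[rotated 2]) auto
    then show ?thesis
      using word_class_eq_iff[of "substitute f w" Y Q] substitute_in_words[of X f Y, OF assms] by simp
  qed
  moreover have "w \<in> word_class X {} w"
    using assms(2) by (simp add: word_class_def pres_eq.refl)
  ultimately show ?thesis unfolding substitute_class_def by blast
qed

lemma carrier_presented_group: "carrier (presented_group X R) = word_class X R ` words X"
  by (simp add: presented_group_def)

lemma one_presented_group: "\<one>\<^bsub>presented_group X R\<^esub> = word_class X R []"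
  by (simp add: presented_group_def)

lemma substitute_class_hom:
  assumes "\<And>x. x \<in> X \<Longrightarrow> f x \<in> words Y"
  shows "substitute_class Y Q f \<in> hom (presented_group X {}) (presented_group Y Q)"
proof -
  have *: "substitute f w \<in> words Y" if "w \<in> words X" for w
    using substitute_in_words[of X f Y] assms that by blast
  show ?thesis
    by (rule homI)
      (auto simp: carrier_presented_group presented_group_mult substitute_class_word_class * assms)
qed

lemma word_class_inverse:
  assumes "w \<in> words X"
  shows "word_class X R (word_inverse w) = inv\<^bsub>presented_group X R\<^esub> (word_class X R w)"
proof -
  interpret group "presented_group X R" by (rule group_presented_group)
  show ?thesis
    by (intro inv_equality[symmetric])
      (use assms in \<open>auto simp: carrier_presented_group presented_group_mult one_presented_group
        word_class_eq_iff pres_eq_inverse_left\<close>)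
qed

lemma word_class_replicate:
  assumes "x \<in> X"
  shows "word_class X R (replicate n (x, b)) = word_class X R [(x, b)] [^]\<^bsub>presented_group X R\<^esub> n"
proof (induction n)
  case 0
  interpret group "presented_group X R" by (rule group_presented_group)
  show ?case by (simp add: one_presented_group)
next
  case (Suc n)
  interpret group "presented_group X R" by (rule group_presented_group)
  have "replicate n (x, b) \<in> words X" using assms by (induction n) auto
  then have "word_class X R (replicate n (x, b) @ [(x, b)])
      = word_class X R (replicate n (x, b)) \<otimes>\<^bsub>presented_group X R\<^esub> word_class X R [(x, b)]"
    using assms by (subst presented_group_mult) auto
  then show ?case using Suc by (simp add: replicate_append_same)
qed

section \<open>Free reduction\<close>

text \<open>Left multiplication by a letter on normal forms: on a reduced word, the only
  cancellation that can occur is with the first letter.\<close>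

fun cons_reduce :: "'a \<times> bool \<Rightarrow> 'a word \<Rightarrow> 'a word" where
  "cons_reduce l [] = [l]"
| "cons_reduce l (m # w) = (if m = letter_inverse l then w else l # m # w)"

definition free_reduce :: "'a word \<Rightarrow> 'a word" where
  "free_reduce w = foldr cons_reduce w []"

definition reduced :: "'a word \<Rightarrow> bool" where
  "reduced = successively (\<lambda>l m. m \<noteq> letter_inverse l)"

lemma reduced_cons_reduce: "reduced w \<Longrightarrow> reduced (cons_reduce l w)"
  by (cases w; cases "tl w") (auto simp: reduced_def)

lemma reduced_foldr_cons_reduce: "reduced w \<Longrightarrow> reduced (foldr cons_reduce u w)"
  by (induction u) (auto simp: reduced_cons_reduce)

text \<open>Reducedness enters when \<open>w\<close> begins with \<open>l\<close>: the tail then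
  does not begin with the inverse of \<open>l\<close>, so putting \<open>l\<close> back causes no
  further cancellation.\<close>

lemma cons_reduce_cancel:
  "reduced w \<Longrightarrow> cons_reduce l (cons_reduce (letter_inverse l) w) = w"
  by (cases w; cases "tl w") (auto simp: reduced_def)

text \<open>Van der Waerden's argument: the letters act on reduced words, with inverse letters
  acting inversely, so this is an action of the free group. Uniqueness of normal forms follows
  without a confluence proof.\<close>

lemma foldr_cons_reduce_cong:
  assumes "pres_eq X {} u v" "reduced w"
  shows "foldr cons_reduce u w = foldr cons_reduce v w"
  using assms
proof (induction arbitrary: w rule: pres_eq.induct)
  case (append u u' v v')
  then show ?case by (simp add: reduced_foldr_cons_reduce)
next
  case (cancel x b)
  then show ?case using cons_reduce_cancel[of w "(x, b)"] by simp
qed auto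

lemma length_free_reduce_le: "length (free_reduce w) \<le> length w"
proof -
  have *: "length (cons_reduce l v) \<le> Suc (length v)" for l and v :: "'a word"
    by (cases v) auto
  show ?thesis
    unfolding free_reduce_def by (induction w) (auto intro: le_trans[OF *])
qed

lemma free_reduce_reduced: "reduced w \<Longrightarrow> free_reduce w = w"
  unfolding free_reduce_def reduced_def
  by (induction w rule: induct_list012) auto

text \<open>Equal elements have the same free reduction, which is \<open>u\<close> itself on one
  side and no longer than \<open>v\<close> on the other.\<close>

lemma reduced_length_minimal:
  assumes "pres_eq X {} u v" "reduced u"
  shows "length u \<le> length v"
proof -
  have "free_reduce u = free_reduce v"
    unfolding free_reduce_def using assms(1) by (rule foldr_cons_reduce_cong) (simp add: reduced_def)
  then show ?thesis
    using free_reduce_reduced[OF assms(2)] length_free_reduce_le[of v] by simp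
qed

lemma pres_eq_cons_reduce:
  assumes "l # w \<in> words X"
  shows "pres_eq X R (l # w) (cons_reduce l w)"
proof (cases "w \<noteq> [] \<and> hd w = letter_inverse l")
  case True
  then obtain v where v: "w = letter_inverse l # v" by (cases w) auto
  obtain x b where l: "l = (x, b)" by (cases l)
  have "pres_eq X R ([(x, b), (x, \<not> b)] @ v) ([] @ v)"
    by (intro pres_eq_append_right pres_eq.cancel) (use assms in \<open>auto simp: v l\<close>)
  then show ?thesis by (simp add: v l)
next
  case False
  then show ?thesis using assms by (cases w) (auto intro: pres_eq.refl)
qed

lemma pres_eq_free_reduce: "w \<in> words X \<Longrightarrow> pres_eq X R w (free_reduce w)"
proof (induction w)
  case Nil
  then show ?case by (auto simp: free_reduce_def intro: pres_eq.refl)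
next
  case (Cons l w)
  then have IH: "pres_eq X R w (free_reduce w)" by simp
  have "pres_eq X R ([l] @ w) ([l] @ free_reduce w)"
    by (intro pres_eq_append_left IH) (use Cons.prems in auto)
  moreover have "pres_eq X R (l # free_reduce w) (cons_reduce l (free_reduce w))"
    by (intro pres_eq_cons_reduce) (use Cons.prems pres_eq_words[OF IH] in auto)
  ultimately show ?case by (auto simp: free_reduce_def intro: pres_eq.trans)
qed

text \<open>Turns concrete identities between short words into a computation; \<open>R\<close> is
  arbitrary because free cancellation is available in every presentation.\<close>

lemma pres_eq_by_free_reduce:
  "\<lbrakk>free_reduce u = free_reduce v; u \<in> words X; v \<in> words X\<rbrakk> \<Longrightarrow> pres_eq X R u v"
  using pres_eq_free_reduce[of u X R] pres_eq_free_reduce[of v X R]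
  by (metis pres_eq.sym pres_eq.trans)

section \<open>Word length\<close>

context group
begin

lemma foldr_mult_closed: "set us \<subseteq> carrier G \<Longrightarrow> foldr (mult G) us \<one> \<in> carrier G"
  by (induction us) auto

lemma foldr_mult_append:
  "\<lbrakk>set us \<subseteq> carrier G; set vs \<subseteq> carrier G\<rbrakk>
    \<Longrightarrow> foldr (mult G) (us @ vs) \<one> = foldr (mult G) us \<one> \<otimes> foldr (mult G) vs \<one>"
  by (induction us) (auto simp: foldr_mult_closed m_assoc)

lemma word_length_le:
  "set ws \<subseteq> S \<union> m_inv G ` S \<Longrightarrow> word_length G S (foldr (mult G) ws \<one>) \<le> length ws"
  unfolding word_length_def by (rule Least_le) blast

lemma word_length_attained:
  assumes "finite_generating_set G S" "g \<in> carrier G"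
  obtains ws where "set ws \<subseteq> S \<union> m_inv G ` S" "length ws = word_length G S g"
    "foldr (mult G) ws \<one> = g"
proof -
  have "\<exists>ws. set ws \<subseteq> S \<union> m_inv G ` S \<and> foldr (mult G) ws \<one> = g"
    using assms word_exists by (auto simp: finite_generating_set_def)
  then have "\<exists>k ws. set ws \<subseteq> S \<union> m_inv G ` S \<and> length ws = k \<and> foldr (mult G) ws \<one> = g"
    by blast
  then have "\<exists>ws. set ws \<subseteq> S \<union> m_inv G ` S \<and> length ws = word_length G S g
      \<and> foldr (mult G) ws \<one> = g"
    unfolding word_length_def by (rule LeastI_ex)
  then show ?thesis using that by blast
qed

lemma word_length_mult_le:
  assumes "finite_generating_set G S" "g \<in> carrier G" "h \<in> carrier G"
  shows "word_length G S (g \<otimes> h) \<le> word_length G S g + word_length G S h"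
proof -
  obtain us where us: "set us \<subseteq> S \<union> m_inv G ` S" "length us = word_length G S g"
    "foldr (mult G) us \<one> = g" using word_length_attained assms by blast
  obtain vs where vs: "set vs \<subseteq> S \<union> m_inv G ` S" "length vs = word_length G S h"
    "foldr (mult G) vs \<one> = h" using word_length_attained assms by blast
  have "S \<union> m_inv G ` S \<subseteq> carrier G" using assms(1) by (auto simp: finite_generating_set_def)
  then have "foldr (mult G) (us @ vs) \<one> = g \<otimes> h" using us vs by (subst foldr_mult_append) auto
  moreover have "word_length G S (foldr (mult G) (us @ vs) \<one>) \<le> length (us @ vs)"
    using us vs by (intro word_length_le) auto
  ultimately show ?thesis using us vs by simp
qed

lemma word_length_pow_le:
  assumes "finite_generating_set G S" "g \<in> carrier G"
  shows "word_length G S (g [^] (n::nat)) \<le> n * word_length G S g"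
proof (induction n)
  case 0
  show ?case using word_length_le[of "[]" S] by simp
next
  case (Suc n)
  then show ?case using word_length_mult_le[OF assms(1), of "g [^] n" g] assms(2) by simp
qed

end

text \<open>Compares an arbitrary finite generating set with the free basis. Spelling each generator
  in the basis turns a shortest expression over \<open>S\<close> into a word at most
  \<open>M\<close> times as long, and a reduced word is the shortest spelling of its
  element.\<close>

lemma reduced_length_le_word_length:
  assumes "finite_generating_set (presented_group X {}) S"
  obtains M :: nat where
    "\<And>w. \<lbrakk>w \<in> words X; reduced w\<rbrakk>
      \<Longrightarrow> length w \<le> M * word_length (presented_group X {}) S (word_class X {} w)"
proof -
  let ?G = "presented_group X {}"
  interpret group ?G by (rule group_presented_group)
  let ?T = "S \<union> m_inv ?G ` S"
  have T: "finite ?T" "?T \<subseteq> carrier ?G" using assms by (auto simp: finite_generating_set_def)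
  have "\<forall>g\<in>?T. \<exists>w. w \<in> words X \<and> word_class X {} w = g"
  proof
    fix g assume "g \<in> ?T"
    with T(2) have "g \<in> word_class X {} ` words X" unfolding carrier_presented_group ..
    then show "\<exists>w. w \<in> words X \<and> word_class X {} w = g" by (elim imageE) metis
  qed
  then obtain r where r: "\<And>g. g \<in> ?T \<Longrightarrow> r g \<in> words X"
    "\<And>g. g \<in> ?T \<Longrightarrow> word_class X {} (r g) = g" by metis
  \<comment> \<open>Any common upper bound of the lengths will do; the sum is one, and it also makes
    sense if there are no generators.\<close>
  define M where "M = (\<Sum>g\<in>?T. length (r g))"
  have M: "length (r g) \<le> M" if "g \<in> ?T" for g
    unfolding M_def using T(1) that by (intro member_le_sum) auto
  have rep: "\<exists>v\<in>words X. word_class X {} v = foldr (mult ?G) ws \<one>\<^bsub>?G\<^esub> \<and> length v \<le> M * length ws"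
    if "set ws \<subseteq> ?T" for ws
    using that
  proof (induction ws)
    case Nil
    show ?case by (rule bexI[of _ "[]"]) (auto simp: one_presented_group)
  next
    case (Cons g ws)
    then obtain v where "v \<in> words X" "word_class X {} v = foldr (mult ?G) ws \<one>\<^bsub>?G\<^esub>"
      "length v \<le> M * length ws" by auto
    moreover have "g \<in> ?T" using Cons.prems by simp
    ultimately show ?case
      using r[of g] M[of g] presented_group_mult[of "r g" X v "{}"]
      by (intro bexI[of _ "r g @ v"]) simp_all
  qed
  show ?thesis
  proof (rule that)
    fix w assume w: "w \<in> words X" "reduced w"
    then have "word_class X {} w \<in> carrier ?G" by (simp add: carrier_presented_group)
    then obtain ws where ws: "set ws \<subseteq> ?T"
      "length ws = word_length ?G S (word_class X {} w)"
      "foldr (mult ?G) ws \<one>\<^bsub>?G\<^esub> = word_class X {} w"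
      using word_length_attained[OF assms] by blast
    from rep[OF ws(1)] obtain v where "word_class X {} w = word_class X {} v" "length v \<le> M * length ws"
      using ws(3) by auto
    then show "length w \<le> M * word_length ?G S (word_class X {} w)"
      using reduced_length_minimal[of X w v] w word_class_eq_iff[OF w(1)] ws(2) by force
  qed
qed

section \<open>The Bestvina-Brady subgroup of the path on four vertices\<close>

definition path_edges :: "nat set set" where
  "path_edges = {{0, 1}, {1, 2}, {2, 3}}"

definition path_relations :: "(nat word \<times> nat word) set" where
  "path_relations =
     {([(u, True), (v, True)], [(v, True), (u, True)]) | u v. {u, v} \<in> path_edges}"

definition edge_word :: "nat \<Rightarrow> nat word" where
  "edge_word i = [(i, True), (Suc i, False)]"

text \<open>Conjugation by the vertex \<open>2\<close>, and by its inverse, in the free basis \<open>edge_word\<close>.\<close>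

definition monodromy :: "nat \<Rightarrow> nat word" where
  "monodromy i = (if i = 0 then [(1, False), (0, True), (1, True)] else [(i, True)])"

definition monodromy_inverse :: "nat \<Rightarrow> nat word" where
  "monodromy_inverse i = (if i = 0 then [(1, True), (0, True), (1, False)] else [(i, True)])"

text \<open>The vertex \<open>v\<close> equals the image of \<open>vertex_offset v\<close> times the vertex \<open>2\<close>.\<close>

definition vertex_offset :: "nat \<Rightarrow> nat word" where
  "vertex_offset v = (if v = 0 then [(0, True), (1, True)] else if v = 1 then [(1, True)]
     else if v = 2 then [] else [(2, False)])"

text \<open>A vertex acts by an affine map: the automorphism followed by a left translation. The
  inverse letter undoes the translation first and then the automorphism.\<close>

fun vertex_act :: "nat \<times> bool \<Rightarrow> nat word \<Rightarrow> nat word" where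
  "vertex_act (v, True) w = vertex_offset v @ substitute monodromy w"
| "vertex_act (v, False) w = substitute monodromy_inverse (word_inverse (vertex_offset v) @ w)"

abbreviation free_eq :: "nat word \<Rightarrow> nat word \<Rightarrow> bool"  (infix "\<approx>" 50) where
  "u \<approx> v \<equiv> pres_eq {..<3} {} u v"

lemma less_3_cases: "i < 3 \<Longrightarrow> i = 0 \<or> i = 1 \<or> i = (2::nat)"
  by auto

lemma monodromy_words: "i \<in> {..<3} \<Longrightarrow> monodromy i \<in> words {..<3}"
  by (auto simp: monodromy_def)

lemma monodromy_inverse_words: "i \<in> {..<3} \<Longrightarrow> monodromy_inverse i \<in> words {..<3}"
  by (auto simp: monodromy_inverse_def)

lemma vertex_offset_words [simp]: "vertex_offset v \<in> words {..<3}"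
  by (auto simp: vertex_offset_def)

lemma substitute_monodromy_words [simp]:
  "w \<in> words {..<3} \<Longrightarrow> substitute monodromy w \<in> words {..<3}"
  "w \<in> words {..<3} \<Longrightarrow> substitute monodromy_inverse w \<in> words {..<3}"
  using substitute_in_words monodromy_words monodromy_inverse_words by metis+

section \<open>The affine action of the Artin group on the free group\<close>

lemma substitute_monodromy_cong:
  "u \<approx> v \<Longrightarrow> substitute monodromy u \<approx> substitute monodromy v"
  "u \<approx> v \<Longrightarrow> substitute monodromy_inverse u \<approx> substitute monodromy_inverse v"
  by (erule substitute_pres_eq[rotated 2]; auto simp: monodromy_def monodromy_inverse_def)+

text \<open>A composite of substitutions is a substitution, so it suffices to compare with the
  identity on each generator, where free reduction decides.\<close>

lemma monodromy_inverse_monodromy: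
  assumes "w \<in> words {..<3}"
  shows "substitute monodromy_inverse (substitute monodromy w) \<approx> w"
proof -
  have "substitute (\<lambda>i. substitute monodromy_inverse (monodromy i)) w
      \<approx> substitute (\<lambda>i. [(i, True)]) w"
    using assms
    by (intro substitute_cong_pres_eq[where X = "{..<3}"] pres_eq_by_free_reduce)
      (auto simp: monodromy_def monodromy_inverse_def free_reduce_def)
  then show ?thesis by (simp add: substitute_substitute substitute_generators)
qed

lemma monodromy_monodromy_inverse:
  assumes "w \<in> words {..<3}"
  shows "substitute monodromy (substitute monodromy_inverse w) \<approx> w"
proof -
  have "substitute (\<lambda>i. substitute monodromy (monodromy_inverse i)) w
      \<approx> substitute (\<lambda>i. [(i, True)]) w"
    using assms
    by (intro substitute_cong_pres_eq[where X = "{..<3}"] pres_eq_by_free_reduce)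
      (auto simp: monodromy_def monodromy_inverse_def free_reduce_def)
  then show ?thesis by (simp add: substitute_substitute substitute_generators)
qed

lemma vertex_act_words [simp]: "w \<in> words {..<3} \<Longrightarrow> vertex_act l w \<in> words {..<3}"
  by (cases "(l, w)" rule: vertex_act.cases) auto

lemma foldr_vertex_act_words [simp]:
  "w \<in> words {..<3} \<Longrightarrow> foldr vertex_act u w \<in> words {..<3}"
  by (induction u) auto

lemma vertex_act_cong: "u \<approx> v \<Longrightarrow> vertex_act l u \<approx> vertex_act l v"
  using pres_eq_words[of "{..<3}" "{}" u v]
  by (cases "(l, u)" rule: vertex_act.cases)
    (auto simp del: substitute_simps
      intro!: pres_eq_append_left substitute_monodromy_cong)

lemma foldr_vertex_act_cong: "u \<approx> v \<Longrightarrow> foldr vertex_act w u \<approx> foldr vertex_act w v"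
  by (induction w) (auto intro: vertex_act_cong)

lemma vertex_act_cancel:
  assumes w: "w \<in> words {..<3}"
  shows "vertex_act (v, b) (vertex_act (v, \<not> b) w) \<approx> w"
proof (cases b)
  case True
  let ?p = "vertex_offset v"
  have "?p @ substitute monodromy (substitute monodromy_inverse (word_inverse ?p @ w))
      \<approx> ?p @ word_inverse ?p @ w"
    by (intro pres_eq_append_left monodromy_monodromy_inverse) (use w in auto)
  moreover have "(?p @ word_inverse ?p) @ w \<approx> [] @ w"
    by (intro pres_eq_append_right pres_eq_inverse_right) (use w in auto)
  ultimately show ?thesis using True by (auto simp del: substitute_simps intro: pres_eq.trans)
next
  case False
  let ?p = "vertex_offset v"
  have "(word_inverse ?p @ ?p) @ substitute monodromy w \<approx> [] @ substitute monodromy w"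
    by (intro pres_eq_append_right pres_eq_inverse_left) (use w in auto)
  then have "substitute monodromy_inverse (word_inverse ?p @ ?p @ substitute monodromy w)
      \<approx> substitute monodromy_inverse (substitute monodromy w)"
    by (intro substitute_monodromy_cong) (simp del: substitute_simps)
  then show ?thesis
    using False monodromy_inverse_monodromy[OF w]
    by (auto simp del: substitute_simps intro: pres_eq.trans)
qed

text \<open>Both composites have the same automorphism part, the square of \<open>monodromy\<close>,
  so only the translation parts have to agree. For the edge from 0 to 1 both reduce to
  \<open>x y y\<close>; for the other two edges \<open>monodromy\<close> fixes the offsets and one
  of them is trivial.\<close>

lemma vertex_act_commute:
  assumes "{u, v} \<in> path_edges" "w \<in> words {..<3}"
  shows "vertex_act (u, True) (vertex_act (v, True) w) \<approx> vertex_act (v, True) (vertex_act (u, True) w)"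
proof -
  have "vertex_offset u @ substitute monodromy (vertex_offset v)
      \<approx> vertex_offset v @ substitute monodromy (vertex_offset u)"
    by (rule pres_eq_by_free_reduce)
      (use assms(1) in \<open>auto simp: path_edges_def doubleton_eq_iff vertex_offset_def monodromy_def
        free_reduce_def\<close>)
  then have "(vertex_offset u @ substitute monodromy (vertex_offset v))
        @ substitute monodromy (substitute monodromy w)
      \<approx> (vertex_offset v @ substitute monodromy (vertex_offset u))
        @ substitute monodromy (substitute monodromy w)"
    by (rule pres_eq_append_right) (use assms(2) in auto)
  then show ?thesis by simp
qed

text \<open>The vertex maps satisfy the defining relations, so they give an action of the Artin
  group on the free group. The word \<open>w\<close> stays arbitrary because in a product the left
  factor acts on the result of the right one.\<close>

lemma foldr_vertex_act_pres_eq: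
  assumes "pres_eq {..<4} path_relations u v" "w \<in> words {..<3}"
  shows "foldr vertex_act u w \<approx> foldr vertex_act v w"
  using assms
proof (induction arbitrary: w rule: pres_eq.induct)
  case (append u u' v v')
  then have "foldr vertex_act u (foldr vertex_act v w) \<approx> foldr vertex_act u' (foldr vertex_act v w)"
    by simp
  moreover have "foldr vertex_act u' (foldr vertex_act v w) \<approx> foldr vertex_act u' (foldr vertex_act v' w)"
    using append by (intro foldr_vertex_act_cong) auto
  ultimately show ?case by (auto intro: pres_eq.trans)
next
  case (cancel x b)
  then show ?case using vertex_act_cancel[of w x b] by (simp del: vertex_act.simps)
next
  case (rel u v)
  then show ?case using vertex_act_commute
    by (auto simp: path_relations_def simp del: vertex_act.simps)
qed (auto intro: pres_eq.intros)

text \<open>In a vertex times the inverse of a neighbour the automorphisms cancel, leaving left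
  translation by a quotient of offsets. The offsets are chosen so that this quotient is the
  generator \<open>i\<close> or its inverse.\<close>

lemma foldr_vertex_act_edge_word:
  assumes "i < 3" "w \<in> words {..<3}"
  shows "foldr vertex_act (edge_word i) w \<approx> (i, True) # w"
    and "foldr vertex_act (word_inverse (edge_word i)) w \<approx> (i, False) # w"
proof -
  have act: "vertex_act (u, True) (vertex_act (v, False) w)
      \<approx> (vertex_offset u @ word_inverse (vertex_offset v)) @ w" for u v
    using pres_eq_append_left[OF monodromy_monodromy_inverse, of "word_inverse (vertex_offset v) @ w"
        "vertex_offset u"] assms(2) by simp
  have *: "(vertex_offset u @ word_inverse (vertex_offset v)) @ w \<approx> [l] @ w"
    if "u = i \<and> v = Suc i \<and> l = (i, True) \<or> u = Suc i \<and> v = i \<and> l = (i, False)" for u v l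
    by (intro pres_eq_append_right pres_eq_by_free_reduce)
      (use that less_3_cases[OF assms(1)] assms(2) in \<open>auto simp: vertex_offset_def free_reduce_def\<close>)
  show "foldr vertex_act (edge_word i) w \<approx> (i, True) # w"
    using pres_eq.trans[OF act[of i "Suc i"] *[of i "Suc i" "(i, True)"]]
    by (simp add: edge_word_def del: vertex_act.simps)
  show "foldr vertex_act (word_inverse (edge_word i)) w \<approx> (i, False) # w"
    using pres_eq.trans[OF act[of "Suc i" i] *[of "Suc i" i "(i, False)"]]
    by (simp add: edge_word_def del: vertex_act.simps)
qed

text \<open>The image of \<open>w\<close> acts as left translation by \<open>w\<close>, so its value
  at the identity recovers \<open>w\<close>. This is what makes the homomorphism injective.\<close>

lemma foldr_vertex_act_substitute:
  assumes "w \<in> words {..<3}"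
  shows "foldr vertex_act (substitute edge_word w) [] \<approx> w"
  using assms
proof (induction w)
  case Nil
  show ?case by (simp add: pres_eq.refl)
next
  case (Cons l w)
  obtain i b where l: "l = (i, b)" by (cases l)
  let ?e = "if b then edge_word i else word_inverse (edge_word i)"
  have i: "i < 3" and w: "w \<in> words {..<3}" using Cons.prems by (auto simp: l)
  have "foldr vertex_act ?e (foldr vertex_act (substitute edge_word w) []) \<approx> foldr vertex_act ?e w"
    using Cons.IH[OF w] by (rule foldr_vertex_act_cong)
  also have "foldr vertex_act ?e w \<approx> (i, b) # w"
    using foldr_vertex_act_edge_word[OF i w] by simp
  finally (pres_eq.trans) show ?case by (simp add: l substitute_Cons)
qed

section \<open>The homomorphism into the Artin group and its injectivity\<close>

lemma edge_word_words: "i \<in> {..<3} \<Longrightarrow> edge_word i \<in> words {..<4}"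
  by (auto simp: edge_word_def)

lemma substitute_edge_word_words [simp]:
  "w \<in> words {..<3} \<Longrightarrow> substitute edge_word w \<in> words {..<4}"
  by (rule substitute_in_words[where X = "{..<3}"]) (auto simp: edge_word_words)

lemma substitute_class_edge_word:
  "w \<in> words {..<3} \<Longrightarrow> substitute_class {..<4} path_relations edge_word (word_class {..<3} {} w)
    = word_class {..<4} path_relations (substitute edge_word w)"
  by (rule substitute_class_word_class) (simp_all add: edge_word_words)

lemma substitute_class_edge_word_hom:
  "substitute_class {..<4} path_relations edge_word
    \<in> hom (presented_group {..<3} {}) (presented_group {..<4} path_relations)"
  by (rule substitute_class_hom) (rule edge_word_words)

lemma substitute_edge_word_pres_eqD:
  assumes "u \<in> words {..<3}" "v \<in> words {..<3}"
    and "pres_eq {..<4} path_relations (substitute edge_word u) (substitute edge_word v)"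
  shows "u \<approx> v"
  using foldr_vertex_act_pres_eq[OF assms(3), of "[]"]
    foldr_vertex_act_substitute[OF assms(1)] foldr_vertex_act_substitute[OF assms(2)]
  by (auto intro: pres_eq.trans pres_eq.sym)

section \<open>Quadratic distortion\<close>

fun distorted_word :: "nat \<Rightarrow> nat word" where
  "distorted_word 0 = []"
| "distorted_word (Suc k) = distorted_word k @ replicate (2 * k) (1, False) @ [(0, True)]
     @ replicate (Suc (2 * k)) (1, True) @ [(2, False)]"

lemma distorted_word_words [simp]: "distorted_word k \<in> words {..<3}"
proof -
  have "replicate n (Suc 0, b) \<in> words {..<3}" for n b by (induction n) auto
  then show ?thesis by (induction k) auto
qed

lemma length_distorted_word: "length (distorted_word k) = 2 * k ^ 2 + k"
  by (induction k) (auto simp: power2_eq_square)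

text \<open>Within a block, neighbouring letters are either equal or belong to different generators;
  consecutive blocks meet in \<open>z\<close> inverse followed by \<open>y\<close> inverse.\<close>

lemma reduced_distorted_word: "reduced (distorted_word k)"
proof -
  let ?P = "\<lambda>l m :: nat \<times> bool. m \<noteq> letter_inverse l"
  have rep: "successively ?P (replicate n l)" for n and l :: "nat \<times> bool"
    by (induction n; cases l) (auto simp: successively_Cons)
  have last: "distorted_word k \<noteq> [] \<Longrightarrow> last (distorted_word k) = (2, False)" for k
    by (cases k) auto
  show ?thesis
    unfolding reduced_def
  proof (induction k)
    case (Suc k)
    then show ?case
      using last[of k] rep
      \<comment> \<open>For \<open>k = 0\<close> the leading power of \<open>y\<close> is empty and
        the block starts with \<open>x\<close>, but then nothing precedes it.\<close>
      by (cases k) (auto simp: successively_append_iff successively_Cons hd_append)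
  qed simp
qed

section \<open>Evaluating the distorted words in the Artin group\<close>

context group
begin

lemma inv_commute:
  assumes "x \<in> carrier G" "y \<in> carrier G" "x \<otimes> y = y \<otimes> x"
  shows "inv x \<otimes> y = y \<otimes> inv x"
proof -
  have "inv x \<otimes> y = inv x \<otimes> (y \<otimes> x) \<otimes> inv x" using assms(1,2) by (simp add: m_assoc)
  also have "\<dots> = inv x \<otimes> (x \<otimes> y) \<otimes> inv x" using assms(3) by simp
  also have "\<dots> = y \<otimes> inv x" using assms(1,2) by (simp add: m_assoc[symmetric])
  finally show ?thesis .
qed

text \<open>The inverse of \<open>x\<close> commutes with \<open>x\<close> times the inverse of
  \<open>y\<close>, so the product of powers is the power of the product, and that product is the
  inverse of \<open>y\<close>.\<close>

lemma inv_pow_mult_pow: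
  assumes "x \<in> carrier G" "y \<in> carrier G" "x \<otimes> y = y \<otimes> x"
  shows "inv x [^] (n::nat) \<otimes> (x \<otimes> inv y) [^] n = inv y [^] n"
proof -
  have xy: "x \<otimes> inv y = inv y \<otimes> x"
    using inv_commute[of y x] assms by simp
  have "inv x \<otimes> (x \<otimes> inv y) = inv y"
    using assms(1,2) by (simp add: m_assoc[symmetric])
  moreover have "(x \<otimes> inv y) \<otimes> inv x = inv y"
    using assms(1,2) by (simp add: xy m_assoc)
  ultimately show ?thesis
    using pow_mult_distrib[of "inv x" "x \<otimes> inv y" n] assms(1,2) by simp
qed

text \<open>Moves a power of \<open>inv c\<close> through the image of one block. It first becomes
  \<open>inv b [^] n\<close>, which passes \<open>a\<close>; one more \<open>inv b\<close> turns it
  into \<open>inv c [^] Suc n\<close>, which passes \<open>d\<close> and absorbs the final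
  \<open>inv c\<close>. The exponent thus grows by 2.\<close>

lemma distorted_power_step:
  assumes G: "a \<in> carrier G" "b \<in> carrier G" "c \<in> carrier G" "d \<in> carrier G"
    and ab: "a \<otimes> b = b \<otimes> a" and bc: "b \<otimes> c = c \<otimes> b" and cd: "c \<otimes> d = d \<otimes> c"
  shows "inv c [^] (n::nat)
      \<otimes> ((c \<otimes> inv b) [^] n \<otimes> (a \<otimes> inv b \<otimes> ((b \<otimes> inv c) [^] Suc n \<otimes> (d \<otimes> inv c))))
    = a \<otimes> d \<otimes> inv c [^] (n + 2)"
proof -
  have "inv b [^] n \<otimes> a = a \<otimes> inv b [^] n"
    using group_commutes_pow[of "inv b" a n] inv_commute[of b a] G ab by simp
  moreover have "inv c [^] Suc n \<otimes> d = d \<otimes> inv c [^] Suc n"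
    using group_commutes_pow[of "inv c" d "Suc n"] inv_commute[of c d] G cd by simp
  moreover have "inv c [^] n \<otimes> (c \<otimes> inv b) [^] n = inv b [^] n"
    using inv_pow_mult_pow[of c b n] G bc by simp
  moreover have "inv b [^] Suc n \<otimes> (b \<otimes> inv c) [^] Suc n = inv c [^] Suc n"
    using inv_pow_mult_pow[of b c "Suc n"] G bc by simp
  moreover have "inv b [^] Suc n = inv b [^] n \<otimes> inv b" "inv c [^] (n + 2) = inv c [^] Suc n \<otimes> inv c"
    by simp_all
  \<comment> \<open>The powers are named so that reassociation treats each of them as a single
    factor.\<close>
  moreover define B C D E where "B = inv b [^] n" and "C = inv c [^] Suc n"
    and "D = (b \<otimes> inv c) [^] Suc n" and "E = (c \<otimes> inv b) [^] n"
  moreover have "B \<in> carrier G" "C \<in> carrier G" "D \<in> carrier G" "E \<in> carrier G"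
    using G unfolding B_def C_def D_def E_def by (simp_all del: nat_pow_Suc)
  ultimately have *: "B \<otimes> a = a \<otimes> B" "C \<otimes> d = d \<otimes> C" "inv c [^] n \<otimes> E = B"
      "(B \<otimes> inv b) \<otimes> D = C" "inv c [^] (n + 2) = C \<otimes> inv c"
    and mem: "B \<in> carrier G" "C \<in> carrier G" "D \<in> carrier G" "E \<in> carrier G"
    by metis+
  have "inv c [^] n \<otimes> (E \<otimes> (a \<otimes> inv b \<otimes> (D \<otimes> (d \<otimes> inv c))))
      = (inv c [^] n \<otimes> E) \<otimes> a \<otimes> (inv b \<otimes> D \<otimes> d \<otimes> inv c)"
    using G mem by (simp add: m_assoc)
  also have "\<dots> = a \<otimes> ((B \<otimes> inv b) \<otimes> D \<otimes> d \<otimes> inv c)"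
    unfolding *(3) *(1) using G mem by (simp add: m_assoc)
  also have "\<dots> = a \<otimes> d \<otimes> (C \<otimes> inv c)"
    unfolding *(4) *(2) using G mem by (simp add: m_assoc)
  finally show ?thesis unfolding *(5) D_def E_def .
qed

end

lemma raag_path: "raag {..<4} path_edges = presented_group {..<4} path_relations"
  by (simp add: raag_def path_relations_def)

text \<open>By induction on \<open>k\<close>: the value for \<open>k\<close> ends in the power
  \<open>2 * k\<close> of the inverse of vertex 2, which is just the power that the next block needs
  in front of it.\<close>

lemma substitute_class_distorted_word:
  fixes G v
  defines "G \<equiv> presented_group {..<4} path_relations"
    and "v \<equiv> \<lambda>i. word_class {..<4} path_relations [(i, True)]"
  shows "substitute_class {..<4} path_relations edge_word (word_class {..<3} {} (distorted_word k))
    = (v 0 \<otimes>\<^bsub>G\<^esub> v 3) [^]\<^bsub>G\<^esub> k \<otimes>\<^bsub>G\<^esub> inv\<^bsub>G\<^esub> (v 2) [^]\<^bsub>G\<^esub> (2 * k)"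
proof -
  let ?F = "presented_group {..<3} {}"
  let ?f = "substitute_class {..<4} path_relations edge_word"
  let ?c = "word_class {..<3} {} :: nat word \<Rightarrow> _"
  interpret G: group G unfolding G_def by (rule group_presented_group)
  interpret F: group ?F by (rule group_presented_group)
  interpret f: group_hom ?F G ?f
    by unfold_locales (simp add: G_def substitute_class_edge_word_hom)
  have v: "v i \<in> carrier G" if "i < 4" for i
    using that by (auto simp: v_def G_def carrier_presented_group)
  have commute: "v i \<otimes>\<^bsub>G\<^esub> v j = v j \<otimes>\<^bsub>G\<^esub> v i" if "{i, j} \<in> path_edges" for i j
  proof -
    have ij: "i < 4" "j < 4" using that by (auto simp: path_edges_def doubleton_eq_iff)
    then have "pres_eq {..<4} path_relations [(i, True), (j, True)] [(j, True), (i, True)]"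
      using that by (intro pres_eq.rel) (auto simp: path_relations_def)
    then show ?thesis using ij by (simp add: v_def G_def presented_group_mult word_class_eq_iff)
  qed
  have inv_v: "word_class {..<4} path_relations [(i, False)] = inv\<^bsub>G\<^esub> (v i)" if "i < 4" for i
    using word_class_inverse[of "[(i, True)]" "{..<4}" path_relations] that by (simp add: v_def G_def)
  have mem: "?c w \<in> carrier ?F" if "w \<in> words {..<3}" for w
    using that by (simp add: carrier_presented_group)
  have f_edge: "?f (?c [(i, True)]) = v i \<otimes>\<^bsub>G\<^esub> inv\<^bsub>G\<^esub> (v (Suc i))"
      "?f (?c [(i, False)]) = v (Suc i) \<otimes>\<^bsub>G\<^esub> inv\<^bsub>G\<^esub> (v i)" if "i < 3" for i
  proof -
    have "[(i, True), (Suc i, False)] = [(i, True)] @ [(Suc i, False)]"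
      "[(Suc i, True), (i, False)] = [(Suc i, True)] @ [(i, False)]" by simp_all
    then have "word_class {..<4} path_relations [(i, True), (Suc i, False)]
        = v i \<otimes>\<^bsub>G\<^esub> inv\<^bsub>G\<^esub> (v (Suc i))"
      "word_class {..<4} path_relations [(Suc i, True), (i, False)]
        = v (Suc i) \<otimes>\<^bsub>G\<^esub> inv\<^bsub>G\<^esub> (v i)"
      using that by (simp_all only: G_def v_def flip: inv_v[unfolded G_def v_def])
        (simp_all add: presented_group_mult inv_v[unfolded v_def G_def, symmetric])
    then show "?f (?c [(i, True)]) = v i \<otimes>\<^bsub>G\<^esub> inv\<^bsub>G\<^esub> (v (Suc i))"
      "?f (?c [(i, False)]) = v (Suc i) \<otimes>\<^bsub>G\<^esub> inv\<^bsub>G\<^esub> (v i)"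
      using that by (simp_all add: substitute_class_edge_word edge_word_def)
  qed
  show ?thesis
  proof (induction k)
    case 0
    show ?case using f.hom_one by (simp add: one_presented_group)
  next
    case (Suc k)
    have rep: "replicate n (i, b) \<in> words {..<3}" if "i < 3" for n b and i :: nat
      using that by (induction n) auto
    have pow: "?c [(1, b)] [^]\<^bsub>?F\<^esub> n = ?c (replicate n (1, b))" for n :: nat and b
      by (simp add: word_class_replicate)
    have "?c (distorted_word (Suc k)) = ?c (distorted_word k)
        \<otimes>\<^bsub>?F\<^esub> (?c [(1, False)] [^]\<^bsub>?F\<^esub> (2 * k) \<otimes>\<^bsub>?F\<^esub> (?c [(0, True)]
        \<otimes>\<^bsub>?F\<^esub> (?c [(1, True)] [^]\<^bsub>?F\<^esub> Suc (2 * k) \<otimes>\<^bsub>?F\<^esub> ?c [(2, False)])))"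
      unfolding pow
      by (simp add: rep presented_group_mult del: replicate_Suc)
    then have "?f (?c (distorted_word (Suc k))) = ?f (?c (distorted_word k))
        \<otimes>\<^bsub>G\<^esub> (?f (?c [(1, False)]) [^]\<^bsub>G\<^esub> (2 * k) \<otimes>\<^bsub>G\<^esub> (?f (?c [(0, True)])
        \<otimes>\<^bsub>G\<^esub> (?f (?c [(1, True)]) [^]\<^bsub>G\<^esub> Suc (2 * k) \<otimes>\<^bsub>G\<^esub> ?f (?c [(2, False)]))))"
      by (simp add: mem f.hom_nat_pow del: F.nat_pow_Suc G.nat_pow_Suc distorted_word.simps)
    also have "\<dots> = (v 0 \<otimes>\<^bsub>G\<^esub> v 3) [^]\<^bsub>G\<^esub> k \<otimes>\<^bsub>G\<^esub> inv\<^bsub>G\<^esub> (v 2) [^]\<^bsub>G\<^esub> (2 * k)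
        \<otimes>\<^bsub>G\<^esub> ((v 2 \<otimes>\<^bsub>G\<^esub> inv\<^bsub>G\<^esub> (v 1)) [^]\<^bsub>G\<^esub> (2 * k)
        \<otimes>\<^bsub>G\<^esub> (v 0 \<otimes>\<^bsub>G\<^esub> inv\<^bsub>G\<^esub> (v 1)
        \<otimes>\<^bsub>G\<^esub> ((v 1 \<otimes>\<^bsub>G\<^esub> inv\<^bsub>G\<^esub> (v 2)) [^]\<^bsub>G\<^esub> Suc (2 * k)
        \<otimes>\<^bsub>G\<^esub> (v 3 \<otimes>\<^bsub>G\<^esub> inv\<^bsub>G\<^esub> (v 2)))))"
      using f_edge[of 0] f_edge[of 1] f_edge[of 2] Suc by (simp add: numeral_2_eq_2 numeral_3_eq_3)
    \<comment> \<open>This is \<open>distorted_power_step\<close> with \<open>n = 2 * k\<close>: the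
      trailing power is carried across the new block.\<close>
    also have "\<dots> = (v 0 \<otimes>\<^bsub>G\<^esub> v 3) [^]\<^bsub>G\<^esub> k
        \<otimes>\<^bsub>G\<^esub> (v 0 \<otimes>\<^bsub>G\<^esub> v 3 \<otimes>\<^bsub>G\<^esub> inv\<^bsub>G\<^esub> (v 2) [^]\<^bsub>G\<^esub> (2 * k + 2))"
      using v commute
      by (subst G.distorted_power_step[symmetric, of "v 0" "v 1" "v 2" "v 3"])
        (auto simp: path_edges_def G.m_assoc simp del: G.nat_pow_Suc)
    also have "\<dots> = (v 0 \<otimes>\<^bsub>G\<^esub> v 3) [^]\<^bsub>G\<^esub> Suc k
        \<otimes>\<^bsub>G\<^esub> inv\<^bsub>G\<^esub> (v 2) [^]\<^bsub>G\<^esub> (2 * Suc k)"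
      using v by (simp add: G.m_assoc)
    finally show ?case .
  qed
qed

lemma substitute_class_edge_word_inj_on:
  "inj_on (substitute_class {..<4} path_relations edge_word) (carrier (presented_group {..<3} {}))"
proof (rule inj_onI)
  let ?f = "substitute_class {..<4} path_relations edge_word"
  fix g h assume "g \<in> carrier (presented_group {..<3} {})" "h \<in> carrier (presented_group {..<3} {})"
    and eq: "?f g = ?f h"
  then obtain u v where uv: "u \<in> words {..<3}" "g = word_class {..<3} {} u"
    "v \<in> words {..<3}" "h = word_class {..<3} {} v"
    by (auto simp: carrier_presented_group)
  have "pres_eq {..<4} path_relations (substitute edge_word u) (substitute edge_word v)"
    using eq uv
    by (simp add: substitute_class_edge_word word_class_eq_iff)
  then show "g = h"
    using substitute_edge_word_pres_eqD uv word_class_eq_iff[OF uv(1)] by simp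
qed

text \<open>The elements given by \<open>distorted_word k\<close> have length quadratic in
  \<open>k\<close> in the free group, while their images have length at most linear in
  \<open>k\<close>. For large \<open>k\<close> this contradicts the lower inequality, whatever the
  generating sets.\<close>

lemma edge_word_not_quasi_isometric:
  assumes S: "finite_generating_set (presented_group {..<3} {}) S"
    and T: "finite_generating_set (presented_group {..<4} path_relations) T"
  shows "\<not> quasi_isometric_embedding (carrier (presented_group {..<3} {}))
    (word_dist (presented_group {..<3} {}) S) (word_dist (presented_group {..<4} path_relations) T)
    (substitute_class {..<4} path_relations edge_word)"
proof
  let ?F = "presented_group {..<3::nat} {}"
  let ?G = "presented_group {..<4} path_relations"
  let ?f = "substitute_class {..<4} path_relations edge_word"
  let ?u = "\<lambda>k. word_class {..<3} {} (distorted_word k)"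
  let ?v = "\<lambda>i. word_class {..<4} path_relations [(i, True)]"
  interpret G: group ?G by (rule group_presented_group)
  interpret F: group ?F by (rule group_presented_group)
  interpret f: group_hom ?F ?G ?f
    by unfold_locales (simp add: substitute_class_edge_word_hom)
  assume "quasi_isometric_embedding (carrier ?F) (word_dist ?F S) (word_dist ?G T) ?f"
  then obtain L \<epsilon> where L: "L \<ge> 1" and \<epsilon>: "\<epsilon> \<ge> 0"
    and qi: "\<And>p q. \<lbrakk>p \<in> carrier ?F; q \<in> carrier ?F\<rbrakk>
      \<Longrightarrow> (1 / L) * word_dist ?F S p q - \<epsilon> \<le> word_dist ?G T (?f p) (?f q)"
    unfolding quasi_isometric_embedding_def by blast
  obtain M :: nat where M: "\<And>w. \<lbrakk>w \<in> words {..<3}; reduced w\<rbrakk>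
      \<Longrightarrow> length w \<le> M * word_length ?F S (word_class {..<3} {} w)"
    using reduced_length_le_word_length[OF S] by blast
  have v: "?v i \<in> carrier ?G" if "i < 4" for i
    using that by (simp add: carrier_presented_group)
  \<comment> \<open>The cost of raising \<open>k\<close> by one: one more factor \<open>v 0\<close>
    times \<open>v 3\<close> and two more inverses of \<open>v 2\<close>.\<close>
  define C where "C = word_length ?G T (?v 0 \<otimes>\<^bsub>?G\<^esub> ?v 3) + 2 * word_length ?G T (inv\<^bsub>?G\<^esub> (?v 2))"
  have upper: "word_length ?G T (?f (?u k)) \<le> k * C" for k
  proof -
    let ?g = "?v 0 \<otimes>\<^bsub>?G\<^esub> ?v 3" and ?h = "inv\<^bsub>?G\<^esub> (?v 2)"
    have gh: "?g \<in> carrier ?G" "?h \<in> carrier ?G" using v by auto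
    have "word_length ?G T (?f (?u k)) \<le>
        word_length ?G T (?g [^]\<^bsub>?G\<^esub> k) + word_length ?G T (?h [^]\<^bsub>?G\<^esub> (2 * k))"
      unfolding substitute_class_distorted_word using G.word_length_mult_le[OF T] gh by simp
    also have "\<dots> \<le> k * word_length ?G T ?g + (2 * k) * word_length ?G T ?h"
      using G.word_length_pow_le[OF T] gh by (intro add_mono) auto
    finally show ?thesis by (simp add: C_def algebra_simps)
  qed
  have bound: "2 * real k ^ 2 + real k \<le> M * L * (k * C + \<epsilon>)" for k
  proof -
    have u: "?u k \<in> carrier ?F" by (simp add: carrier_presented_group)
    \<comment> \<open>Measuring from the identity, which the homomorphism fixes, turns both
      distances into word lengths.\<close>
    have "(1 / L) * word_length ?F S (?u k) - \<epsilon> \<le> word_length ?G T (?f (?u k))"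
      using qi[OF F.one_closed u] u by (simp add: word_dist_def)
    also have "\<dots> \<le> k * C" using upper by (metis of_nat_mono of_nat_mult)
    finally have "word_length ?F S (?u k) \<le> L * (k * C + \<epsilon>)"
      using L by (simp add: field_simps)
    then have "M * real (word_length ?F S (?u k)) \<le> M * (L * (k * C + \<epsilon>))"
      by (rule mult_left_mono) simp
    moreover have "real (2 * k ^ 2 + k) \<le> M * word_length ?F S (?u k)"
      using M[of "distorted_word k"]
      by (metis distorted_word_words length_distorted_word of_nat_mono of_nat_mult reduced_distorted_word)
    ultimately show ?thesis by (simp add: mult.assoc)
  qed
  \<comment> \<open>For such \<open>k\<close>, which is at least 1, the right side of
    \<open>bound\<close> is at most \<open>k * (M * L * (C + \<epsilon>))\<close>, hence at most the
    square of \<open>k\<close>, whereas the left side exceeds that square.\<close>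
  obtain k :: nat where k: "real k > M * L * (C + \<epsilon>)" using reals_Archimedean2 by blast
  have nonneg: "M * L * (C + \<epsilon>) \<ge> 0" using L \<epsilon> by simp
  with k have "0 < real k" by linarith
  then have k1: "real k \<ge> 1" by simp
  then have "k * C + \<epsilon> \<le> k * (C + \<epsilon>)"
    using mult_right_mono[OF k1 \<epsilon>] by (simp add: distrib_left)
  then have "M * L * (k * C + \<epsilon>) \<le> M * L * (k * (C + \<epsilon>))"
    using L by (intro mult_left_mono) auto
  also have "\<dots> = k * (M * L * (C + \<epsilon>))" by simp
  also have "\<dots> \<le> real k * real k" using k by (intro mult_left_mono) auto
  finally show False
    using bound[of k] k1 zero_le_square[of "real k"] unfolding power2_eq_square by linarith
qed

theorem mainTheorem4:
  shows "\<exists>(V :: nat set) (E :: nat set set) (n :: nat) \<phi>.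
           finite_simplicial_graph V E \<and>
           \<phi> \<in> hom (free_group_of_rank n) (raag V E) \<and>
           inj_on \<phi> (carrier (free_group_of_rank n)) \<and>
           (\<forall>S T. finite_generating_set (free_group_of_rank n) S \<longrightarrow>
                  finite_generating_set (raag V E) T \<longrightarrow>
                  \<not> quasi_isometric_embedding (carrier (free_group_of_rank n))
                      (word_dist (free_group_of_rank n) S) (word_dist (raag V E) T) \<phi>)"
proof -
  have "finite_simplicial_graph {..<4} path_edges"
    by (auto simp: finite_simplicial_graph_def path_edges_def)
  then show ?thesis
    using substitute_class_edge_word_hom substitute_class_edge_word_inj_on
      edge_word_not_quasi_isometric
    unfolding free_group_of_rank_def raag_path[symmetric] by blast
qed

end
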